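(* The numerical flux $\mathbf{f}^{\tt EC}(\boldsymbol{u}^-,\boldsymbol{u}^+)\in\mathbb{R}^{N+3}$ with components \begin{align*} f^{\tt EC}_1 &= \{\!\{hu_m\}\!\},\\ f^{\tt EC}_2 &= \{\!\{hu_m\}\!\}\{\!\{u_m\}\!\} + \sum_{j=1}^N \frac{\{\!\{h\alpha_j\}\!\}\{\!\{\alpha_j\}\!\}}{2j+1},\\ f^{\tt EC}_{i+2} &= \{\!\{hu_m\}\!\}\{\!\{\alpha_i\}\!\} + \{\!\{h\alpha_i\}\!\}\{\!\{u_m\}\!\} + \sum_{j,k=1}^N A_{ijk}\{\!\{h\alpha_j\}\!\}\{\!\{\alpha_k\}\!\},\qquad i=1,\dots,N,\\ f^{\tt EC}_{N+3} &= 0, \end{align*} which approximates the flux $\mathbf{f}$ of the augmented SWME system, fulfills the entropy conservation condition $$[\![\boldsymbol{w}]\!]^{\rm T}\, \mathbf{f}^{\tt EC}(\boldsymbol{u}^-,\boldsymbol{u}^+) - \{\!\{\boldsymbol{w}^{\rm T} \mathbf{B}\}\!\}\, [\![\boldsymbol{u}]\!] = [\![\boldsymbol{w}^{\rm T}\mathbf{f} - \mathbb{F}]\!]$$ for all pairs of states $\boldsymbol{u}^-,\boldsymbol{u}^+$ with $h^\pm>0$, where $\mathbb{F}$ is the entropy flux $$\mathbb{F}(\boldsymbol{u}) = \frac{h u_m^3}{2} + \frac{3}{2} h u_m \sum_{i=1}^N \frac{\alpha_i^2}{2i+1} + g h u_m (h+b) + \sum_{i,j,k=1}^N \frac{1}{2i+1}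 \left( A_{i j k} + B_{i j k}\right) h \alpha_i \alpha_j \alpha_k.$$
   Context: $N\ge1$ is an integer and $g>0$ is a constant. A state is $\boldsymbol{u}=(h,hu_m,h\alpha_1,\dots,h\alpha_N,b)^{\rm T}\in\mathbb{R}^{N+3}$ with $h>0$; $u_m,\alpha_1,\dots,\alpha_N$ are recovered by division by $h$. Jumps and averages: for any quantity $\varphi=\varphi(\boldsymbol{u})$ put $\varphi^\pm=\varphi(\boldsymbol{u}^\pm)$, $[\![\varphi]\!]=\varphi^+-\varphi^-$ and $\{\!\{\varphi\}\!\}=\tfrac12(\varphi^++\varphi^-)$ (componentwise for vectors; averages of products are averages of the pointwise product, e.g. $\{\!\{hu_m\}\!\}=\tfrac12(h^+u_m^++h^-u_m^-)$). Coefficients: with $L_i$ the classical Legendre polynomials ($L_i(1)=1$) and $\phi_i(\zeta)=(-1)^iL_i(2\zeta-1)$ on $[0,1]$, $$A_{i j k} =(2i+1) \int_0^1 \phi_i \phi_j \phi_k\, {\rm d} \zeta, \qquad B_{i j k} = (2 i+1) \int_0^1 \phi_i^{\prime}(\zeta)\left(\int_0^\zeta \phi_j(s)\,{\rm d} s\right) \phi_k(\zeta)\, {\rm d} \zeta,\quad i,j,k=1,\dots,N.$$ The augmented SWME system (with the trivial equation $\partial_t b=0$) is $\partial_t\boldsymbol{u}+\partial_x\mathbf{f}(\boldsymbol{u})+\mathbf{B}(\boldsymbol{u})\partial_x\boldsymbol{u}=\mathbf{S}(\boldsymbol{u})$ ($\mathbf{S}$ a source term), where the flux $\mathbf{f}(\boldsymbol{u})\in\mathbb{R}^{N+3}$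 has components $f_1=hu_m$, $f_2=hu_m^2+h\sum_{i=1}^N\frac{\alpha_i^2}{2i+1}$, $f_{i+2}=2hu_m\alpha_i+h\sum_{j,k=1}^NA_{ijk}\alpha_j\alpha_k$ for $i=1,\dots,N$, $f_{N+3}=0$, and $\mathbf{B}(\boldsymbol{u})\in\mathbb{R}^{(N+3)\times(N+3)}$ is the matrix acting on $q\in\mathbb{R}^{N+3}$ by $(\mathbf{B}q)_1=0$, $(\mathbf{B}q)_2=gh(q_1+q_{N+3})$, $(\mathbf{B}q)_{i+2}=-u_mq_{i+2}+\sum_{j,k=1}^NB_{ijk}\alpha_k\,q_{j+2}$ for $i=1,\dots,N$, $(\mathbf{B}q)_{N+3}=0$. The (augmented) entropy variables $\boldsymbol{w}=\boldsymbol{w}(\boldsymbol{u})\in\mathbb{R}^{N+3}$ are $$w_1=-\frac{u_m^2}{2}-\frac12\sum_{i=1}^N\frac{\alpha_i^2}{2i+1}+g(h+b),\quad w_2=u_m,\quad w_{i+2}=\frac{\alpha_i}{2i+1}\ (i=1,\dots,N),\quad w_{N+3}=gh.$$ *)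

theory Defs
  imports "HOL-Analysis.Analysis" "Jordan_Normal_Form.Matrix"
begin

unbundle no inner_syntax
no_notation Finite_Cartesian_Product.vec_nth (infixl \<open>$\<close> 90)

section \<open>Legendre basis and coefficients\<close>

text \<open>Rodrigues' formula for the classical Legendre polynomials.\<close>

definition legendre :: "nat \<Rightarrow> real poly" where
  "legendre n = Polynomial.smult (1 / (2 ^ n * fact n)) ((pderiv ^^ n) ([:-1, 0, 1:] ^ n))"

lemma poly_higher_pderiv_root_power:
  fixes q :: "real poly"
  shows "poly ((pderiv ^^ n) ([:-1, 1:] ^ n * q)) 1 = fact n * poly q 1"
proof (induction n arbitrary: q)
  case 0
  then show ?case by simp
next
  case (Suc n)
  have "pderiv ([:-1, 1:] ^ Suc n * q) =
      [:-1, 1:] ^ n * (Polynomial.smult (real (Suc n)) q + [:-1, 1:] * pderiv q)"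
    by (simp add: pderiv_mult pderiv_power_Suc pderiv_pCons algebra_simps
        del: power_Suc) (simp add: algebra_simps smult_add_right)
  then show ?case
    using Suc.IH by (simp add: funpow_swap1 del: funpow.simps(2) add: funpow_Suc_right)
qed

lemma legendre_at_1: "poly (legendre n) 1 = 1"
proof -
  have "[:-1, 0, 1:] = [:-1, 1:] * [:1, 1::real:]"
    by simp
  then have "[:-1, 0, 1:] ^ n = [:-1, 1:] ^ n * [:1, 1::real:] ^ n"
    by (simp only: power_mult_distrib)
  then show ?thesis
    by (simp add: legendre_def poly_higher_pderiv_root_power)
qed

definition leg_basis :: "nat \<Rightarrow> real \<Rightarrow> real" where
  "leg_basis i \<zeta> = (-1) ^ i * poly (legendre i) (2 * \<zeta> - 1)"

definition coeff_A :: "nat \<Rightarrow> nat \<Rightarrow> nat \<Rightarrow> real" where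
  "coeff_A i j k = (2 * real i + 1) * integral {0..1} (\<lambda>\<zeta>. leg_basis i \<zeta> * leg_basis j \<zeta> * leg_basis k \<zeta>)"

definition coeff_B :: "nat \<Rightarrow> nat \<Rightarrow> nat \<Rightarrow> real" where
  "coeff_B i j k = (2 * real i + 1) *
     integral {0..1} (\<lambda>\<zeta>. deriv (leg_basis i) \<zeta> * integral {0..\<zeta>} (leg_basis j) * leg_basis k \<zeta>)"

section \<open>States\<close>

text \<open>
  Vectors and matrices are indexed from 0 here, so that a state
  (h, h u, h \<alpha>_1, ..., h \<alpha>_N, b) of dimension N + 3 has h, h u and b at the
  positions 0, 1 and N + 2, and h \<alpha>_i at the position i + 1 for i = 1, ..., N.
  The function \<open>aug_vec N x y z s\<close> builds the vector (x, y, z 1, ..., z N, s).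
\<close>

definition aug_vec :: "nat \<Rightarrow> real \<Rightarrow> real \<Rightarrow> (nat \<Rightarrow> real) \<Rightarrow> real \<Rightarrow> real vec" where
  "aug_vec N x y z s =
     vec (N + 3) (\<lambda>r. if r = 0 then x else if r = 1 then y else if r = N + 2 then s else z (r - 1))"

definition height :: "real vec \<Rightarrow> real" where
  "height u = u $ 0"

definition discharge :: "real vec \<Rightarrow> real" where
  "discharge u = u $ 1"

definition hmoment :: "nat \<Rightarrow> real vec \<Rightarrow> real" where
  "hmoment i u = u $ (i + 1)"

definition bottom :: "nat \<Rightarrow> real vec \<Rightarrow> real" where
  "bottom N u = u $ (N + 2)"

definition velocity :: "real vec \<Rightarrow> real" where
  "velocity u = discharge u / height u"

definition moment :: "nat \<Rightarrow> real vec \<Rightarrow> real" where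
  "moment i u = hmoment i u / height u"

section \<open>The augmented system and its entropy variables\<close>

definition flux :: "nat \<Rightarrow> real vec \<Rightarrow> real vec" where
  "flux N u = aug_vec N
     (height u * velocity u)
     (height u * (velocity u)\<^sup>2 + height u * (\<Sum>i=1..N. (moment i u)\<^sup>2 / (2 * real i + 1)))
     (\<lambda>i. 2 * height u * velocity u * moment i u
        + height u * (\<Sum>j=1..N. \<Sum>k=1..N. coeff_A i j k * moment j u * moment k u))
     0"

text \<open>
  The entries of the matrix \<open>\<bold>B\<close>; its action on a vector is spelled out in
  \<open>noncons_matrix_mult\<close> below.
\<close>

definition noncons_matrix :: "nat \<Rightarrow> real \<Rightarrow> real vec \<Rightarrow> real mat" where
  "noncons_matrix N g u = mat (N + 3) (N + 3) (\<lambda>(r, c).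
     if r = 1 then (if c = 0 \<or> c = N + 2 then g * height u else 0)
     else if r \<in> {2..N + 1} \<and> c \<in> {2..N + 1} then
       (if r = c then - velocity u else 0)
       + (\<Sum>k=1..N. coeff_B (r - 1) (c - 1) k * moment k u)
     else 0)"

lemma noncons_matrix_mult:
  assumes "q \<in> carrier_vec (N + 3)"
  shows "noncons_matrix N g u *\<^sub>v q = aug_vec N
     0
     (g * height u * (q $ 0 + q $ (N + 2)))
     (\<lambda>i. - velocity u * q $ (i + 1)
        + (\<Sum>j=1..N. \<Sum>k=1..N. coeff_B i j k * moment k u * q $ (j + 1)))
     0"
proof (rule eq_vecI)
  let ?M = "noncons_matrix N g u"
  let ?v = "aug_vec N 0 (g * height u * (q $ 0 + q $ (N + 2)))
     (\<lambda>i. - velocity u * q $ (i + 1)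
        + (\<Sum>j=1..N. \<Sum>k=1..N. coeff_B i j k * moment k u * q $ (j + 1))) 0"
  show "dim_vec (?M *\<^sub>v q) = dim_vec ?v"
    by (simp add: noncons_matrix_def aug_vec_def)
  fix r assume "r < dim_vec ?v"
  then have r: "r < N + 3" by (simp add: aug_vec_def)
  have *: "(?M *\<^sub>v q) $ r = (\<Sum>c<N + 3. ?M $$ (r, c) * q $ c)"
    using r assms by (simp add: noncons_matrix_def scalar_prod_def atLeast0LessThan)
  consider "r = 0" | "r = 1" | "r = N + 2" | "2 \<le> r" "r \<le> N + 1" using r by linarith
  then show "(?M *\<^sub>v q) $ r = ?v $ r"
  proof cases
    case 2
    have "(\<Sum>c<N + 3. ?M $$ (r, c) * q $ c)
        = (\<Sum>c<N + 3. if c \<in> {0, N + 2} then g * height u * q $ c else 0)"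
      using 2 by (intro sum.cong) (auto simp: noncons_matrix_def)
    also have "\<dots> = (\<Sum>c\<in>{0, N + 2}. g * height u * q $ c)"
      by (intro sum.mono_neutral_cong_right) auto
    finally show ?thesis
      using 2 * by (simp add: aug_vec_def algebra_simps)
  next
    case 4
    let ?S = "\<lambda>c. \<Sum>k=1..N. coeff_B (r - 1) (c - 1) k * moment k u"
    have "(\<Sum>c<N + 3. ?M $$ (r, c) * q $ c)
        = (\<Sum>c\<in>{2..N + 1}. ((if r = c then - velocity u else 0) + ?S c) * q $ c)"
      using 4 by (intro sum.mono_neutral_cong_right) (auto simp: noncons_matrix_def)
    also have "\<dots> = (\<Sum>c\<in>{2..N + 1}. if r = c then - velocity u * q $ c else 0)
        + (\<Sum>c\<in>{2..N + 1}. ?S c * q $ c)"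
      unfolding sum.distrib[symmetric] by (intro sum.cong) (auto simp: algebra_simps)
    also have "(\<Sum>c\<in>{2..N + 1}. if r = c then - velocity u * q $ c else 0) = - velocity u * q $ r"
      using 4 by (simp add: sum.delta')
    also have "(\<Sum>c\<in>{2..N + 1}. ?S c * q $ c)
        = (\<Sum>j=1..N. \<Sum>k=1..N. coeff_B (r - 1) j k * moment k u * q $ (j + 1))"
      by (rule sum.reindex_bij_witness[of _ "\<lambda>j. j + 1" "\<lambda>c. c - 1"])
        (auto simp: sum_distrib_right)
    finally show ?thesis
      using 4 * by (simp add: aug_vec_def)
  qed (use * in \<open>auto simp: noncons_matrix_def aug_vec_def\<close>)
qed

definition entropy_vars :: "nat \<Rightarrow> real \<Rightarrow> real vec \<Rightarrow> real vec" where
  "entropy_vars N g u = aug_vec N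
     (- (velocity u)\<^sup>2 / 2 - (\<Sum>i=1..N. (moment i u)\<^sup>2 / (2 * real i + 1)) / 2
        + g * (height u + bottom N u))
     (velocity u)
     (\<lambda>i. moment i u / (2 * real i + 1))
     (g * height u)"

definition entropy_flux :: "nat \<Rightarrow> real \<Rightarrow> real vec \<Rightarrow> real" where
  "entropy_flux N g u =
     height u * velocity u ^ 3 / 2
     + 3 / 2 * height u * velocity u * (\<Sum>i=1..N. (moment i u)\<^sup>2 / (2 * real i + 1))
     + g * height u * velocity u * (height u + bottom N u)
     + (\<Sum>i=1..N. \<Sum>j=1..N. \<Sum>k=1..N. 1 / (2 * real i + 1) * (coeff_A i j k + coeff_B i j k)
          * height u * moment i u * moment j u * moment k u)"

section \<open>Jumps, averages and the numerical flux\<close>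

text \<open>
  In all of these the first state is the left one (superscript minus) and the
  second the right one (superscript plus). Vectors whose dimension is not part
  of their type have no scaling by the type class, hence the second average.
\<close>

definition jump :: "real vec \<Rightarrow> real vec \<Rightarrow> (real vec \<Rightarrow> 'a::minus) \<Rightarrow> 'a" where
  "jump ul ur f = f ur - f ul"

definition avg :: "real vec \<Rightarrow> real vec \<Rightarrow> (real vec \<Rightarrow> real) \<Rightarrow> real" where
  "avg ul ur f = 1 / 2 * (f ur + f ul)"

definition avg_vec :: "real vec \<Rightarrow> real vec \<Rightarrow> (real vec \<Rightarrow> real vec) \<Rightarrow> real vec" where
  "avg_vec ul ur f = (1 / 2) \<cdot>\<^sub>v (f ur + f ul)"

definition flux_EC :: "nat \<Rightarrow> real vec \<Rightarrow> real vec \<Rightarrow> real vec" where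
  "flux_EC N ul ur = (let av = avg ul ur in aug_vec N
     (av (\<lambda>u. height u * velocity u))
     (av (\<lambda>u. height u * velocity u) * av velocity
        + (\<Sum>j=1..N. av (\<lambda>u. height u * moment j u) * av (moment j) / (2 * real j + 1)))
     (\<lambda>i. av (\<lambda>u. height u * velocity u) * av (moment i)
        + av (\<lambda>u. height u * moment i u) * av velocity
        + (\<Sum>j=1..N. \<Sum>k=1..N. coeff_A i j k * av (\<lambda>u. height u * moment j u) * av (moment k)))
     0)"

lemma flux_EC_consistent: "flux_EC N u u = flux N u"
  by (simp add: flux_EC_def flux_def avg_def Let_def power2_eq_square
      sum_distrib_left algebra_simps)

end

theory Submission
  imports Defs
begin

text \<open>
  Write \<open>\<langle>x, y\<rangle> = \<Sum>\<^sub>i x\<^sub>i y\<^sub>i / (2 i + 1)\<close> for the pairing of moment sequences,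
  \<open>C(x, y, z) = \<Sum> x\<^sub>i y\<^sub>j z\<^sub>k \<integral> \<phi>\<^sub>i \<phi>\<^sub>j \<phi>\<^sub>k\<close> for the symmetric cubic form of the basis,
  \<open>a\<close> for the sequence of the moments \<open>\<alpha>\<^sub>i\<close>, and \<open>[ ]\<close>, \<open>{ }\<close> for jumps and averages.

  The factor \<open>1 / (2 i + 1)\<close> in the entropy variables cancels the factor \<open>2 i + 1\<close> in the
  coefficients, so the tensor \<open>A\<close> turns into \<open>C\<close>. The tensor \<open>B\<close> turns into
  \<open>b\<^sub>i\<^sub>j\<^sub>k = \<integral> \<phi>\<^sub>i' \<Phi>\<^sub>j \<phi>\<^sub>k\<close>, where \<open>\<Phi>\<^sub>j\<close> is the primitive of \<open>\<phi>\<^sub>j\<close> that vanishes at 0.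
  For \<open>j \<ge> 1\<close> it vanishes at 1 too, so integration by parts gives
  \<open>b\<^sub>i\<^sub>j\<^sub>k + b\<^sub>k\<^sub>j\<^sub>i = - \<integral> \<phi>\<^sub>i \<phi>\<^sub>j \<phi>\<^sub>k\<close>. The first and the last index of
  \<open>B\<close> are contracted with the same sequence \<open>a\<close>, hence only this symmetrization enters and \<open>B\<close> acts
  as \<open>- C / 2\<close> (\<open>sum_coeff_B\<close>). From here on nothing but the symmetry of \<open>C\<close> and of the
  pairing is used about the coefficients.

  The right-hand side becomes the jump of \<open>h u \<langle>a, a\<rangle> + h C(a, a, a) / 2\<close>
  (\<open>entropy_potential\<close>). On the left (\<open>entropy_jump_flux_EC\<close>, \<open>noncons_work\<close>) the terms
  with \<open>g\<close> cancel, since \<open>[h + b] {h u}\<close> occurs once in each of the two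
  products, and there remain
  \<open>[u] \<langle>{h a}, {a}\<rangle> + {u} \<langle>[a], {h a}\<rangle> + {u \<langle>a, [h a]\<rangle>}\<close>
  and \<open>C([a], {h a}, {a}) + {C(a, [h a], a)} / 2\<close>, where the jump of \<open>h a\<close> inside an average
  is the same for both states. The discrete product rule
  \<open>[p q] = [p] {q} + {p} [q]\<close>, applied to \<open>h a\<close> against \<open>u a\<close> in the pairing and, after
  the symmetrization of \<open>C([a], _, {a})\<close>, to \<open>h a\<close> against the product of the two
  remaining moments in the cubic form, identifies these with the right-hand side.
\<close>

section \<open>The Legendre basis and its primitives\<close>

text \<open>
  The primitive is the Rodrigues formula with one derivative fewer: its vanishing
  at the end points can then be read off the multiplicity of the factor \<open>x\<^sup>2 - 1\<close>.
  The formula is meaningful for \<open>j \<ge> 1\<close> only.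
\<close>

definition leg_primitive :: "nat \<Rightarrow> real \<Rightarrow> real" where
  "leg_primitive j \<zeta> = (-1) ^ j / 2 * (1 / (2 ^ j * fact j))
     * poly ((pderiv ^^ (j - 1)) ([:-1, 0, 1:] ^ j)) (2 * \<zeta> - 1)"

lemma power_dvd_pderiv:
  fixes q p :: "real poly"
  assumes "q ^ Suc n dvd p"
  shows "q ^ n dvd pderiv p"
proof -
  obtain r where r: "p = q ^ Suc n * r" using assms by (rule dvdE)
  show ?thesis
    unfolding r pderiv_mult pderiv_power_Suc
    by (intro dvd_add) (simp_all add: dvd_mult dvd_mult2 dvd_smult)
qed

lemma power_dvd_higher_pderiv:
  fixes q p :: "real poly"
  assumes "q ^ (n + m) dvd p"
  shows "q ^ n dvd (pderiv ^^ m) p"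
  using assms
proof (induction m arbitrary: n)
  case (Suc m)
  from Suc.IH[of "Suc n"] Suc.prems have "q ^ Suc n dvd (pderiv ^^ m) p" by simp
  then show ?case by (simp only: funpow.simps o_apply power_dvd_pderiv)
qed simp

text \<open>
  Only \<open>j - 1\<close> derivatives are applied to \<open>(x\<^sup>2 - 1)\<^sup>j\<close>, so one factor \<open>x\<^sup>2 - 1\<close> survives.
  At 1 this is the orthogonality of \<open>\<phi>\<^sub>j\<close> to the constants.
\<close>

lemma leg_primitive_boundary:
  assumes "j \<ge> 1"
  shows "leg_primitive j 0 = 0" and "leg_primitive j 1 = 0"
proof -
  have "[:-1, 0, 1::real:] ^ 1 dvd (pderiv ^^ (j - 1)) ([:-1, 0, 1:] ^ j)"
    using assms by (intro power_dvd_higher_pderiv) simp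
  then obtain r where r: "(pderiv ^^ (j - 1)) ([:-1, 0, 1::real:] ^ j) = [:-1, 0, 1:] * r"
    by (auto elim: dvdE)
  show "leg_primitive j 0 = 0" and "leg_primitive j 1 = 0"
    unfolding leg_primitive_def r by simp_all
qed

lemma poly_affine_has_derivative:
  fixes p :: "real poly"
  shows "((\<lambda>\<zeta>. poly p (2 * \<zeta> - 1)) has_real_derivative 2 * poly (pderiv p) (2 * \<zeta> - 1)) (at \<zeta> within S)"
  by (rule derivative_eq_intros refl | simp)+

lemma leg_primitive_has_derivative:
  assumes "j \<ge> 1"
  shows "(leg_primitive j has_real_derivative leg_basis j \<zeta>) (at \<zeta> within S)"
proof -
  have "pderiv ((pderiv ^^ (j - 1)) p) = (pderiv ^^ j) p" for p :: "real poly"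
    using assms by (cases j) auto
  then show ?thesis
    unfolding leg_primitive_def[abs_def] leg_basis_def legendre_def
    by (auto intro!: derivative_eq_intros poly_affine_has_derivative)
qed

lemma leg_basis_has_derivative:
  "(leg_basis i has_real_derivative (-1) ^ i * (2 * poly (pderiv (legendre i)) (2 * \<zeta> - 1)))
     (at \<zeta> within S)"
  unfolding leg_basis_def[abs_def]
  by (intro DERIV_cmult poly_affine_has_derivative)

lemma deriv_leg_basis:
  "deriv (leg_basis i) = (\<lambda>\<zeta>. (-1) ^ i * (2 * poly (pderiv (legendre i)) (2 * \<zeta> - 1)))"
  by (intro ext DERIV_imp_deriv leg_basis_has_derivative)

lemma continuous_on_leg [continuous_intros]:
  "continuous_on S (leg_basis i)" "continuous_on S (deriv (leg_basis i))"
  unfolding deriv_leg_basis unfolding leg_basis_def[abs_def] by (intro continuous_intros)+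

lemma continuous_on_leg_primitive [continuous_intros]:
  "continuous_on S (leg_primitive i)"
  unfolding leg_primitive_def[abs_def] by (intro continuous_intros)

lemma integral_leg_basis:
  assumes "j \<ge> 1" and "\<zeta> \<ge> 0"
  shows "integral {0..\<zeta>} (leg_basis j) = leg_primitive j \<zeta>"
proof -
  have "(leg_basis j has_integral (leg_primitive j \<zeta> - leg_primitive j 0)) {0..\<zeta>}"
    using assms
    by (intro fundamental_theorem_of_calculus)
      (auto simp: has_real_derivative_iff_has_vector_derivative[symmetric]
        intro: leg_primitive_has_derivative)
  then show ?thesis
    using leg_primitive_boundary(1)[OF assms(1)] by (simp add: integral_unique)
qed

section \<open>The moment coefficients\<close>

definition triple_product :: "nat \<Rightarrow> nat \<Rightarrow> nat \<Rightarrow> real" where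
  "triple_product i j k = integral {0..1} (\<lambda>\<zeta>. leg_basis i \<zeta> * leg_basis j \<zeta> * leg_basis k \<zeta>)"

lemma triple_product_swap: "triple_product i j k = triple_product k j i"
  by (simp add: triple_product_def mult_ac)

lemma coeff_A_eq_triple_product: "coeff_A i j k = (2 * real i + 1) * triple_product i j k"
  by (simp add: coeff_A_def triple_product_def)

definition transport_product :: "nat \<Rightarrow> nat \<Rightarrow> nat \<Rightarrow> real" where
  "transport_product i j k =
     integral {0..1} (\<lambda>\<zeta>. deriv (leg_basis i) \<zeta> * leg_primitive j \<zeta> * leg_basis k \<zeta>)"

lemma coeff_B_eq_transport_product:
  assumes "j \<ge> 1"
  shows "coeff_B i j k = (2 * real i + 1) * transport_product i j k"
  unfolding coeff_B_def transport_product_def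
  by (intro arg_cong2[of _ _ _ _ "(*)"] refl integral_cong) (simp add: integral_leg_basis[OF assms])

text \<open>
  The sum of the two transport integrands is \<open>(\<phi>\<^sub>i \<phi>\<^sub>k)' \<Phi>\<^sub>j\<close>; integration by parts moves the
  derivative to \<open>\<Phi>\<^sub>j\<close>, and there is no boundary term because \<open>\<Phi>\<^sub>j\<close> vanishes at 0 and 1.
\<close>

lemma transport_product_swap:
  assumes "j \<ge> 1"
  shows "transport_product i j k + transport_product k j i = - triple_product i j k"
proof -
  let ?f = "\<lambda>\<zeta>. deriv (leg_basis i) \<zeta> * leg_primitive j \<zeta> * leg_basis k \<zeta>"
  let ?g = "\<lambda>\<zeta>. deriv (leg_basis k) \<zeta> * leg_primitive j \<zeta> * leg_basis i \<zeta>"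
  let ?h = "\<lambda>\<zeta>. leg_basis i \<zeta> * leg_basis j \<zeta> * leg_basis k \<zeta>"
  let ?P = "\<lambda>\<zeta>. leg_basis i \<zeta> * leg_primitive j \<zeta> * leg_basis k \<zeta>"
  have deriv: "(leg_basis n has_real_derivative deriv (leg_basis n) \<zeta>) (at \<zeta> within S)" for n \<zeta> S
    unfolding deriv_leg_basis by (rule leg_basis_has_derivative)
  have "(?P has_real_derivative (?f \<zeta> + ?g \<zeta> + ?h \<zeta>)) (at \<zeta> within {0..1})" for \<zeta>
    by (rule derivative_eq_intros deriv leg_primitive_has_derivative[OF assms] refl)+
      (simp add: algebra_simps)
  then have "((\<lambda>\<zeta>. ?f \<zeta> + ?g \<zeta> + ?h \<zeta>) has_integral (?P 1 - ?P 0)) {0..1}"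
    by (intro fundamental_theorem_of_calculus)
      (auto simp: has_real_derivative_iff_has_vector_derivative[symmetric])
  then have "integral {0..1} (\<lambda>\<zeta>. ?f \<zeta> + ?g \<zeta> + ?h \<zeta>) = 0"
    using leg_primitive_boundary[OF assms] by (simp add: integral_unique)
  moreover have "?f integrable_on {0..1}" "?g integrable_on {0..1}" "?h integrable_on {0..1}"
    by (intro integrable_continuous_real continuous_intros)+
  ultimately show ?thesis
    by (simp add: transport_product_def triple_product_def integral_add integrable_add)
qed

section \<open>The cubic form of the moments\<close>

definition cubic_form :: "nat \<Rightarrow> (nat \<Rightarrow> real) \<Rightarrow> (nat \<Rightarrow> real) \<Rightarrow> (nat \<Rightarrow> real) \<Rightarrow> real" where
  "cubic_form N x y z = (\<Sum>i=1..N. \<Sum>j=1..N. \<Sum>k=1..N. triple_product i j k * x i * y j * z k)"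

lemma sum_swap_outer:
  fixes f :: "nat \<Rightarrow> nat \<Rightarrow> nat \<Rightarrow> real"
  shows "(\<Sum>i\<in>I. \<Sum>j\<in>J. \<Sum>k\<in>I. f i j k) = (\<Sum>i\<in>I. \<Sum>j\<in>J. \<Sum>k\<in>I. f k j i)"
proof -
  have "(\<Sum>i\<in>I. \<Sum>j\<in>J. \<Sum>k\<in>I. f i j k) = (\<Sum>j\<in>J. \<Sum>i\<in>I. \<Sum>k\<in>I. f i j k)"
    by (rule sum.swap)
  also have "\<dots> = (\<Sum>j\<in>J. \<Sum>k\<in>I. \<Sum>i\<in>I. f i j k)"
    by (intro sum.cong refl sum.swap)
  also have "\<dots> = (\<Sum>k\<in>I. \<Sum>j\<in>J. \<Sum>i\<in>I. f i j k)"
    by (rule sum.swap)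
  finally show ?thesis .
qed

lemma cubic_form_swap: "cubic_form N x y z = cubic_form N z y x"
proof -
  have "cubic_form N x y z
      = (\<Sum>i=1..N. \<Sum>j=1..N. \<Sum>k=1..N. triple_product k j i * x k * y j * z i)"
    unfolding cubic_form_def by (rule sum_swap_outer)
  then show ?thesis
    by (simp add: cubic_form_def triple_product_swap[of _ _ i for i] mult_ac)
qed

lemma cubic_form_linear:
  "cubic_form N (\<lambda>i. x i - x' i) y z = cubic_form N x y z - cubic_form N x' y z"
  "cubic_form N x (\<lambda>j. y j - y' j) z = cubic_form N x y z - cubic_form N x y' z"
  "cubic_form N x (\<lambda>j. c * y j) z = c * cubic_form N x y z"
  "cubic_form N x (\<lambda>j. y j + y' j) z = cubic_form N x y z + cubic_form N x y' z"
  "cubic_form N x y (\<lambda>k. c * z k) = c * cubic_form N x y z"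
  "cubic_form N x y (\<lambda>k. z k + z' k) = cubic_form N x y z + cubic_form N x y z'"
  by (simp_all add: cubic_form_def algebra_simps sum.distrib sum_subtractf sum_distrib_left)

lemma sum_coeff_A:
  "(\<Sum>i=1..N. x i / (2 * real i + 1) * (\<Sum>j=1..N. \<Sum>k=1..N. coeff_A i j k * y j * z k))
    = cubic_form N x y z"
  unfolding cubic_form_def sum_distrib_left
  by (intro sum.cong refl) (simp add: coeff_A_eq_triple_product field_simps)

text \<open>
  The weight \<open>x\<^sub>i x\<^sub>k\<close> is symmetric, so the transport product may be replaced by half of
  its symmetrization in \<open>i\<close> and \<open>k\<close>. This is how the nonconservative moment terms become
  comparable with the flux.
\<close>

lemma sum_coeff_B:
  "(\<Sum>i=1..N. x i / (2 * real i + 1) * (\<Sum>j=1..N. \<Sum>k=1..N. coeff_B i j k * x k * y j))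
    = - cubic_form N x y x / 2"
proof -
  let ?b = "\<lambda>i j k. transport_product i j k * x i * y j * x k"
  have "(\<Sum>i=1..N. x i / (2 * real i + 1) * (\<Sum>j=1..N. \<Sum>k=1..N. coeff_B i j k * x k * y j))
      = (\<Sum>i=1..N. \<Sum>j=1..N. \<Sum>k=1..N. ?b i j k)" (is "?L = _")
    unfolding sum_distrib_left
    by (intro sum.cong refl) (simp add: coeff_B_eq_transport_product field_simps)
  moreover have "(\<Sum>i=1..N. \<Sum>j=1..N. \<Sum>k=1..N. ?b i j k)
      = (\<Sum>i=1..N. \<Sum>j=1..N. \<Sum>k=1..N. ?b k j i)"
    by (rule sum_swap_outer)
  ultimately have "2 * ?L = (\<Sum>i=1..N. \<Sum>j=1..N. \<Sum>k=1..N. ?b i j k + ?b k j i)"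
    by (simp add: sum.distrib)
  also have "\<dots> = (\<Sum>i=1..N. \<Sum>j=1..N. \<Sum>k=1..N. - (triple_product i j k * x i * y j * x k))"
  proof (intro sum.cong refl)
    fix i j k assume "j \<in> {1..N}"
    then have "transport_product i j k + transport_product k j i = - triple_product i j k"
      by (intro transport_product_swap) simp
    moreover have "?b i j k + ?b k j i
        = (transport_product i j k + transport_product k j i) * x i * y j * x k"
      by (simp add: algebra_simps)
    ultimately show "?b i j k + ?b k j i = - (triple_product i j k * x i * y j * x k)"
      by simp
  qed
  also have "\<dots> = - cubic_form N x y x"
    by (simp add: cubic_form_def sum_negf)
  finally show ?thesis by simp
qed

section \<open>Vectors in block form\<close>

lemma aug_vec_carrier [simp]: "aug_vec N x y z s \<in> carrier_vec (N + 3)"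
  by (simp add: aug_vec_def)

lemma aug_vec_minus:
  "aug_vec N x y z s - aug_vec N x' y' z' s'
    = aug_vec N (x - x') (y - y') (\<lambda>i. z i - z' i) (s - s')"
  by (rule eq_vecI) (auto simp: aug_vec_def)

lemma aug_vec_scalar_prod:
  "aug_vec N x y z s \<bullet> aug_vec N x' y' z' s'
    = x * x' + y * y' + (\<Sum>i=1..N. z i * z' i) + s * s'"
proof -
  let ?v = "aug_vec N x y z s" and ?v' = "aug_vec N x' y' z' s'"
  have "?v \<bullet> ?v' = (\<Sum>r<N + 3. ?v $ r * ?v' $ r)"
    by (simp add: scalar_prod_def aug_vec_def atLeast0LessThan)
  also have "{..<N + 3} = {0, 1, N + 2} \<union> {2..N + 1}"
    by auto
  also have "(\<Sum>r\<in>{0, 1, N + 2} \<union> {2..N + 1}. ?v $ r * ?v' $ r)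
      = (\<Sum>r\<in>{0, 1, N + 2}. ?v $ r * ?v' $ r) + (\<Sum>r\<in>{2..N + 1}. ?v $ r * ?v' $ r)"
    by (rule sum.union_disjoint) auto
  also have "(\<Sum>r\<in>{2..N + 1}. ?v $ r * ?v' $ r) = (\<Sum>i=1..N. z i * z' i)"
    by (rule sum.reindex_bij_witness[of _ "\<lambda>i. i + 1" "\<lambda>r. r - 1"]) (auto simp: aug_vec_def)
  finally show ?thesis
    by (simp add: aug_vec_def)
qed

section \<open>Entropy conservation\<close>

definition moment_pairing :: "nat \<Rightarrow> (nat \<Rightarrow> real) \<Rightarrow> (nat \<Rightarrow> real) \<Rightarrow> real" where
  "moment_pairing N x y = (\<Sum>i=1..N. x i * y i / (2 * real i + 1))"

lemma moment_pairing_linear: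
  "moment_pairing N (\<lambda>i. x i - x' i) y = moment_pairing N x y - moment_pairing N x' y"
  "moment_pairing N x (\<lambda>j. y j - y' j) = moment_pairing N x y - moment_pairing N x y'"
  "moment_pairing N x (\<lambda>j. c * y j) = c * moment_pairing N x y"
  "moment_pairing N (\<lambda>j. c * x j) y = c * moment_pairing N x y"
  "moment_pairing N (\<lambda>j. x j + x' j) y = moment_pairing N x y + moment_pairing N x' y"
  "moment_pairing N x (\<lambda>j. y j + y' j) = moment_pairing N x y + moment_pairing N x y'"
  by (simp_all add: moment_pairing_def algebra_simps sum.distrib sum_subtractf sum_distrib_left
      diff_divide_distrib add_divide_distrib)

lemma moment_pairing_commute: "moment_pairing N x y = moment_pairing N y x"
  by (simp add: moment_pairing_def mult.commute)

text \<open>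
  Transposition moves the matrix to the increment \<open>q\<close>, where its action is known
  explicitly. The first term is the work of the hydrostatic pressure against surface
  and bottom, which balances the \<open>g (h + b)\<close> part of the first entropy variable.
\<close>

lemma noncons_work:
  assumes "q \<in> carrier_vec (N + 3)"
  shows "(transpose_mat (noncons_matrix N g u) *\<^sub>v entropy_vars N g u) \<bullet> q
    = g * height u * velocity u * (height q + bottom N q)
      - velocity u * moment_pairing N (\<lambda>i. moment i u) (\<lambda>i. hmoment i q)
      - cubic_form N (\<lambda>i. moment i u) (\<lambda>i. hmoment i q) (\<lambda>i. moment i u) / 2"
proof -
  have "(transpose_mat (noncons_matrix N g u) *\<^sub>v entropy_vars N g u) \<bullet> q
      = entropy_vars N g u \<bullet> (noncons_matrix N g u *\<^sub>v q)"
    using assms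
      transpose_vec_mult_scalar[of "noncons_matrix N g u" "N + 3" "N + 3" q "entropy_vars N g u"]
    by (simp add: entropy_vars_def noncons_matrix_def comm_scalar_prod[of _ "N + 3"])
  also have "\<dots> = g * height u * velocity u * (height q + bottom N q)
      - velocity u * moment_pairing N (\<lambda>i. moment i u) (\<lambda>i. hmoment i q)
      + (\<Sum>i=1..N. moment i u / (2 * real i + 1)
          * (\<Sum>j=1..N. \<Sum>k=1..N. coeff_B i j k * moment k u * hmoment j q))"
    unfolding noncons_matrix_mult[OF assms] entropy_vars_def aug_vec_scalar_prod
    by (simp add: moment_pairing_def height_def bottom_def hmoment_def distrib_left sum.distrib
        sum_distrib_left sum_subtractf algebra_simps)
  finally show ?thesis
    unfolding sum_coeff_B by simp
qed

text \<open>
  The kinetic terms \<open>h u\<^sup>3\<close> and the gravity terms cancel. Since \<open>A\<close> contributes \<open>C\<close> and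
  \<open>B\<close> contributes \<open>- C / 2\<close> to the entropy flux, half of the cubic term
  of the flux, tested with the entropy variables, is left.
\<close>

lemma entropy_potential:
  "entropy_vars N g u \<bullet> flux N u - entropy_flux N g u
    = height u * velocity u * moment_pairing N (\<lambda>i. moment i u) (\<lambda>i. moment i u)
      + height u * cubic_form N (\<lambda>i. moment i u) (\<lambda>i. moment i u) (\<lambda>i. moment i u) / 2"
proof -
  let ?a = "\<lambda>i. moment i u"
  let ?E = "moment_pairing N ?a ?a" and ?C = "cubic_form N ?a ?a ?a"
  have E: "(\<Sum>i=1..N. (moment i u)\<^sup>2 / (2 * real i + 1)) = ?E"
    by (simp add: moment_pairing_def power2_eq_square)
  have "(\<Sum>i=1..N. moment i u / (2 * real i + 1) *
        (2 * height u * velocity u * moment i u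
          + height u * (\<Sum>j=1..N. \<Sum>k=1..N. coeff_A i j k * moment j u * moment k u)))
      = 2 * height u * velocity u * ?E + height u * (\<Sum>i=1..N. moment i u / (2 * real i + 1)
          * (\<Sum>j=1..N. \<Sum>k=1..N. coeff_A i j k * moment j u * moment k u))"
    unfolding moment_pairing_def sum_distrib_left[of _ _ "{1..N}"] sum.distrib[symmetric]
    by (intro sum.cong refl) (simp add: distrib_left sum_distrib_left mult_ac)
  also have "\<dots> = 2 * height u * velocity u * ?E + height u * ?C"
    by (simp only: sum_coeff_A)
  finally have flux: "entropy_vars N g u \<bullet> flux N u
      = (- (velocity u)\<^sup>2 / 2 - ?E / 2 + g * (height u + bottom N u)) * (height u * velocity u)
        + velocity u * (height u * (velocity u)\<^sup>2 + height u * ?E)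
        + (2 * height u * velocity u * ?E + height u * ?C)"
    unfolding entropy_vars_def flux_def aug_vec_scalar_prod E by simp
  have "(\<Sum>i=1..N. \<Sum>j=1..N. \<Sum>k=1..N. 1 / (2 * real i + 1) * (coeff_A i j k + coeff_B i j k)
          * height u * moment i u * moment j u * moment k u)
      = height u * ((\<Sum>i=1..N. moment i u / (2 * real i + 1)
            * (\<Sum>j=1..N. \<Sum>k=1..N. coeff_A i j k * moment j u * moment k u))
          + (\<Sum>i=1..N. moment i u / (2 * real i + 1)
            * (\<Sum>j=1..N. \<Sum>k=1..N. coeff_B i j k * moment k u * moment j u)))"
    unfolding sum_distrib_left sum.distrib[symmetric]
    by (intro sum.cong refl) (simp add: add_divide_distrib distrib_left distrib_right mult_ac)
  also have "\<dots> = height u * ?C / 2"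
    by (simp only: sum_coeff_A sum_coeff_B) (simp add: algebra_simps)
  finally have "entropy_flux N g u = height u * velocity u ^ 3 / 2
      + 3 / 2 * height u * velocity u * ?E
      + g * height u * velocity u * (height u + bottom N u) + height u * ?C / 2"
    unfolding entropy_flux_def E by simp
  with flux show ?thesis
    by (simp add: field_simps power2_eq_square power3_eq_cube)
qed

text \<open>
  By \<open>[p\<^sup>2] / 2 = [p] {p}\<close> the kinetic part of the jump of the first entropy variable,
  multiplied by the mass flux \<open>{h u}\<close>, cancels the terms \<open>{h u} {u}\<close> and \<open>{h u} {\<alpha>\<^sub>i}\<close> that
  the momentum and moment fluxes carry, tested with \<open>[u]\<close> and \<open>[\<alpha>\<^sub>i] / (2 i + 1)\<close>.
\<close>

lemma entropy_jump_flux_EC: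
  fixes ul ur :: "real vec"
  defines "av \<equiv> avg ul ur"
  defines "a \<equiv> \<lambda>i. av (moment i)" and "m \<equiv> \<lambda>i. av (\<lambda>u. height u * moment i u)"
    and "d \<equiv> \<lambda>i. moment i ur - moment i ul"
  shows "jump ul ur (entropy_vars N g) \<bullet> flux_EC N ul ur
    = g * jump ul ur (\<lambda>u. height u + bottom N u) * av (\<lambda>u. height u * velocity u)
      + jump ul ur velocity * moment_pairing N m a
      + av velocity * moment_pairing N d m
      + cubic_form N d m a"
proof -
  let ?hu = "av (\<lambda>u. height u * velocity u)"
  let ?E = "\<lambda>u. moment_pairing N (\<lambda>i. moment i u) (\<lambda>i. moment i u)"
  have E: "(\<Sum>i=1..N. (moment i u)\<^sup>2 / (2 * real i + 1)) = ?E u" for u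
    by (simp add: moment_pairing_def power2_eq_square)
  have m: "(\<Sum>j=1..N. av (\<lambda>u. height u * moment j u) * av (moment j) / (2 * real j + 1))
      = moment_pairing N m a"
    by (simp add: moment_pairing_def m_def a_def)
  \<comment> \<open>\<open>[p\<^sup>2] = 2 [p] {p}\<close>, summed over the moments\<close>
  have da: "2 * moment_pairing N d a = ?E ur - ?E ul"
    unfolding d_def a_def av_def avg_def moment_pairing_linear
    by (simp add: moment_pairing_commute[of N "\<lambda>i. moment i ul" "\<lambda>i. moment i ur"]
        field_simps)
  have "(\<Sum>i=1..N. (moment i ur / (2 * real i + 1) - moment i ul / (2 * real i + 1)) *
        (?hu * a i + m i * av velocity
          + (\<Sum>j=1..N. \<Sum>k=1..N. coeff_A i j k * m j * a k)))
      = ?hu * moment_pairing N d a + av velocity * moment_pairing N d m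
        + (\<Sum>i=1..N. d i / (2 * real i + 1) * (\<Sum>j=1..N. \<Sum>k=1..N. coeff_A i j k * m j * a k))"
    unfolding moment_pairing_def sum_distrib_left[of _ _ "{1..N}"] sum.distrib[symmetric]
    by (intro sum.cong refl)
      (simp add: d_def diff_divide_distrib[symmetric] add_divide_distrib sum_divide_distrib
        distrib_left sum_distrib_left mult_ac)
  then have moments: "(\<Sum>i=1..N. (moment i ur / (2 * real i + 1) - moment i ul / (2 * real i + 1)) *
        (?hu * a i + m i * av velocity
          + (\<Sum>j=1..N. \<Sum>k=1..N. coeff_A i j k * m j * a k)))
      = ?hu * moment_pairing N d a + av velocity * moment_pairing N d m + cubic_form N d m a"
    by (simp only: sum_coeff_A)
  have uu: "(velocity ur)\<^sup>2 - (velocity ul)\<^sup>2 = 2 * av velocity * jump ul ur velocity"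
    by (simp add: av_def avg_def jump_def power2_eq_square algebra_simps)
  have "jump ul ur (entropy_vars N g) \<bullet> flux_EC N ul ur
      = (- ((velocity ur)\<^sup>2 - (velocity ul)\<^sup>2) / 2 - (?E ur - ?E ul) / 2
            + g * jump ul ur (\<lambda>u. height u + bottom N u)) * ?hu
        + jump ul ur velocity * (?hu * av velocity + moment_pairing N m a)
        + (?hu * moment_pairing N d a + av velocity * moment_pairing N d m + cubic_form N d m a)"
    unfolding jump_def entropy_vars_def aug_vec_minus flux_EC_def Let_def av_def[symmetric]
      aug_vec_scalar_prod E m moments[unfolded a_def m_def]
    by (simp add: moments[unfolded a_def m_def] a_def m_def algebra_simps diff_divide_distrib)
  also have "\<dots> = g * jump ul ur (\<lambda>u. height u + bottom N u) * ?hu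
      + jump ul ur velocity * moment_pairing N m a + av velocity * moment_pairing N d m
      + cubic_form N d m a"
    unfolding uu da[symmetric] by (simp add: algebra_simps)
  finally show ?thesis .
qed

theorem theorem2:
  fixes N :: nat and g :: real and ul ur :: "real vec"
  assumes "N \<ge> 1" and "g > 0"
    and "ul \<in> carrier_vec (N + 3)" and "ur \<in> carrier_vec (N + 3)"
    and "height ul > 0" and "height ur > 0"
  shows "jump ul ur (entropy_vars N g) \<bullet> flux_EC N ul ur
      - avg_vec ul ur (\<lambda>u. transpose_mat (noncons_matrix N g u) *\<^sub>v entropy_vars N g u)
          \<bullet> jump ul ur (\<lambda>u. u)
    = jump ul ur (\<lambda>u. entropy_vars N g u \<bullet> flux N u - entropy_flux N g u)"
proof -
  let ?q = "jump ul ur (\<lambda>u. u)"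
  let ?W = "\<lambda>u. transpose_mat (noncons_matrix N g u) *\<^sub>v entropy_vars N g u"
  let ?al = "\<lambda>i. moment i ul" and ?ar = "\<lambda>i. moment i ur"
  have q: "?q \<in> carrier_vec (N + 3)"
    using assms by (simp add: jump_def)
  have W: "?W u \<in> carrier_vec (N + 3)" for u
    by (rule mult_mat_vec_carrier[of _ _ "N + 3"]) (simp_all add: noncons_matrix_def entropy_vars_def)
  have avg: "avg_vec ul ur ?W \<bullet> ?q = (?W ur \<bullet> ?q + ?W ul \<bullet> ?q) / 2"
    using W q by (simp add: avg_vec_def add_scalar_prod_distrib[of _ "N + 3"]
        smult_scalar_prod_distrib[of _ "N + 3"])
  have hq: "height ?q = height ur - height ul" and bq: "bottom N ?q = bottom N ur - bottom N ul"
    using assms by (simp_all add: jump_def height_def bottom_def)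
  have hm: "height u * moment i u = hmoment i u" if "height u > 0" for i u
    using that by (simp add: moment_def)
  \<comment> \<open>the conserved variable equals height times moment only because the heights are nonzero\<close>
  have mq: "hmoment i ?q = height ur * moment i ur - height ul * moment i ul" if "i \<in> {1..N}" for i
    using assms that by (simp add: hm) (simp add: jump_def hmoment_def)
  have pair: "moment_pairing N x (\<lambda>i. hmoment i ?q)
      = height ur * moment_pairing N x ?ar - height ul * moment_pairing N x ?al" for x
  proof -
    have "moment_pairing N x (\<lambda>i. hmoment i ?q)
        = moment_pairing N x (\<lambda>i. height ur * moment i ur - height ul * moment i ul)"
      unfolding moment_pairing_def by (intro sum.cong refl) (simp only: mq)
    then show ?thesis by (simp only: moment_pairing_linear)
  qed
  have cub: "cubic_form N x (\<lambda>i. hmoment i ?q) x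
      = height ur * cubic_form N x ?ar x - height ul * cubic_form N x ?al x" for x
  proof -
    have "cubic_form N x (\<lambda>i. hmoment i ?q) x
        = cubic_form N x (\<lambda>i. height ur * moment i ur - height ul * moment i ul) x"
      unfolding cubic_form_def by (intro sum.cong refl) (simp only: mq)
    then show ?thesis by (simp only: cubic_form_linear)
  qed
  show ?thesis
    unfolding avg noncons_work[OF q] entropy_jump_flux_EC pair cub hq bq entropy_potential
    \<comment> \<open>By multilinearity both sides become polynomials in the heights and velocities and in the
      values of the two forms on \<open>?al\<close> and \<open>?ar\<close>. The symmetries bring these values into a
      normal form, which makes the identity one of commutative algebra.\<close>
    unfolding jump_def avg_def entropy_potential moment_pairing_linear cubic_form_linear
      moment_pairing_commute[of N ?ar ?al]
      cubic_form_swap[of N ?ar ?ar ?al] cubic_form_swap[of N ?ar ?al ?al]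
    by (simp add: field_simps)
qed

end
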